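(* For all integers $n \geq 0$ and $k\ge 1$ and all real $x$, $$c_n^{(k)}(x) = \sum_{m=0}^n \frac{(-1)^{n-m}}{(m+1)^k} \genfrac{[}{]}{0pt}{}{n}{m}_x$$ and $$\widehat{c}_n^{(k)}(-x) = (-1)^n \sum_{m=0}^n \frac{1}{(m+1)^k} \genfrac{[}{]}{0pt}{}{n}{m}_x.$$
   Context: For real $z$ and integer $n\ge 0$, $\binom{z}{n} = \frac{z(z-1)\cdots(z-n+1)}{n!}$. For integers $n\ge0$, $k\ge1$, the poly-Cauchy polynomials of the first and second kind are $$c_n^{(k)}(x) = n! \int_{0}^{1}\!\! \cdots \int_{0}^{1} \binom{t_1 \cdots t_k - x}{n}\,dt_1 \cdots dt_k,\qquad \widehat{c}_n^{(k)}(x) = n! \int_{0}^{1}\!\! \cdots \int_{0}^{1} \binom{x - t_1 \cdots t_k}{n}\,dt_1 \cdots dt_k.$$ The generalized Stirling numbers of the first kind are $\genfrac{[}{]}{0pt}{}{n}{m}_x = \sum_{i=0}^{n-m} \binom{i+m}{m}\genfrac{[}{]}{0pt}{}{n}{i+m} x^i$ for $0 \leq m \leq n$ and $x\in\mathbb{R}$, where $\genfrac{[}{]}{0pt}{}{n}{m}$ are the unsigned Stirling numbers of the first kind and $x^0=1$. *)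

theory Defs
  imports "HOL-Analysis.Analysis" "HOL-Combinatorics.Stirling"
begin

text \<open>
  The \<open>k\<close>-fold integral over the unit cube is the Lebesgue integral with respect to the
  \<open>k\<close>-fold product of Lebesgue measure on the real line; points of the cube are functions
  \<open>t\<close> with coordinates \<open>t 1, \<dots>, t k\<close> (and \<open>undefined\<close> outside the index set).
  The intended range of the parameter is \<open>k \<ge> 1\<close>.
\<close>

definition poly_cauchy1 :: "nat \<Rightarrow> nat \<Rightarrow> real \<Rightarrow> real" where
  "poly_cauchy1 k n x = fact n *
     (LINT t : ({1..k} \<rightarrow>\<^sub>E {0..1}) | (\<Pi>\<^sub>M i\<in>{1..k}. lborel).
        (((\<Prod>i=1..k. t i) - x) gchoose n))"

definition poly_cauchy2 :: "nat \<Rightarrow> nat \<Rightarrow> real \<Rightarrow> real" where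
  "poly_cauchy2 k n x = fact n *
     (LINT t : ({1..k} \<rightarrow>\<^sub>E {0..1}) | (\<Pi>\<^sub>M i\<in>{1..k}. lborel).
        ((x - (\<Prod>i=1..k. t i)) gchoose n))"

text \<open>
  The library constant \<^const>\<open>stirling\<close> denotes the unsigned Stirling numbers of the first kind.
  The following is meant for \<open>m \<le> n\<close>.
\<close>

definition gen_stirling1 :: "real \<Rightarrow> nat \<Rightarrow> nat \<Rightarrow> real" where
  "gen_stirling1 x n m =
     (\<Sum>i=0..n-m. real ((i + m) choose m) * real (stirling n (i + m)) * x ^ i)"

end

theory Submission
  imports Defs
begin

text \<open>
  The generalized Stirling numbers are the coefficients in \<open>y\<close> of the rising factorial of
  \<open>x + y\<close>. Up to the sign \<open>(-1)^n\<close> both integrands are this rising factorial, taken at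
  \<open>y = -t\<^sub>1\<dots>t\<^sub>k\<close> and \<open>y = t\<^sub>1\<dots>t\<^sub>k\<close> respectively; by Fubini, the integral of
  \<open>(t\<^sub>1\<dots>t\<^sub>k)^m\<close> over the cube is \<open>1 / (m + 1)^k\<close>.
\<close>

text \<open>Expand the rising factorial in powers of its argument, with unsigned Stirling
  coefficients, apply the binomial theorem to each power, and collect the powers of
  \<open>y\<close>.\<close>

lemma pochhammer_add_eq_gen_stirling1:
  "pochhammer (x + y) n = (\<Sum>m=0..n. gen_stirling1 x n m * y ^ m)"
proof -
  \<comment> \<open>The summands are flipped to \<open>y + x\<close> because
    \<open>binomial_ring\<close> gives the first one the exponent \<open>m\<close>.\<close>
  have "pochhammer (x + y) n = (\<Sum>j\<le>n. real (stirling n j) * (y + x) ^ j)"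
    by (simp add: stirling_pochhammer add.commute)
  also have "\<dots> = (\<Sum>j\<le>n. \<Sum>m\<le>j. real (j choose m) * real (stirling n j) * x ^ (j - m) * y ^ m)"
    by (simp add: binomial_ring sum_distrib_left mult_ac)
  also have "\<dots> = (\<Sum>m\<le>n. \<Sum>j=m..n. real (j choose m) * real (stirling n j) * x ^ (j - m) * y ^ m)"
  proof -
    \<comment> \<open>\<open>sum.swap_restrict\<close> leaves the triangle
      \<open>m \<le> j \<le> n\<close> as set comprehensions; these rewrites turn them into
      intervals.\<close>
    have eq_sets: "j \<le> n \<Longrightarrow> {m. m \<le> n \<and> m \<le> j} = {..j}" "{j. j \<le> n \<and> m \<le> j} = {m..n}" for j m
      by auto
    show ?thesis
      using sum.swap_restrict[of "{..n}" "{..n}"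
          "\<lambda>j m. real (j choose m) * real (stirling n j) * x ^ (j - m) * y ^ m" "\<lambda>j m. m \<le> j"]
      by (simp add: eq_sets)
  qed
  also have "\<dots> = (\<Sum>m=0..n. gen_stirling1 x n m * y ^ m)"
    unfolding atMost_atLeast0
  proof (rule sum.cong[OF refl])
    fix m assume "m \<in> {0..n}"
    \<comment> \<open>Substitute \<open>j = i + m\<close>; \<open>m \<le> n\<close> gives the upper
      bound \<open>(n - m) + m = n\<close>.\<close>
    then have "(\<Sum>j=m..n. real (j choose m) * real (stirling n j) * x ^ (j - m) * y ^ m) =
      (\<Sum>i=0..n-m. real ((i + m) choose m) * real (stirling n (i + m)) * x ^ i * y ^ m)"
      using sum.shift_bounds_cl_nat_ivl
        [of "\<lambda>j. real (j choose m) * real (stirling n j) * x ^ (j - m) * y ^ m" 0 m "n - m"]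
      by simp
    then show "(\<Sum>j=m..n. real (j choose m) * real (stirling n j) * x ^ (j - m) * y ^ m) =
      gen_stirling1 x n m * y ^ m"
      by (simp add: gen_stirling1_def sum_distrib_right)
  qed
  finally show ?thesis .
qed

lemma has_bochner_integral_power_01:
  "has_bochner_integral lborel (\<lambda>t::real. indicator {0..1} t * t ^ m) (1 / real (m + 1))"
proof -
  have "set_integrable lborel {0..1} (\<lambda>t::real. t ^ m)"
    by (intro borel_integrable_atLeastAtMost' continuous_intros)
  then show ?thesis
    using integral_power[of 0 1 m]
    by (simp add: has_bochner_integral_iff set_integrable_def mult.commute)
qed

text \<open>Once the indicator of the cube is split over the coordinates, the integrand is a product
  of one-variable functions, so Fubini reduces both claims to the unit interval.\<close>

lemma
  fixes k m :: nat
  shows set_integrable_prod_power_cube: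
      "set_integrable (\<Pi>\<^sub>M i\<in>{1..k}. lborel) ({1..k} \<rightarrow>\<^sub>E {0..1::real}) (\<lambda>t. (\<Prod>i=1..k. t i) ^ m)"
    and set_integral_prod_power_cube:
      "(LINT t : ({1..k} \<rightarrow>\<^sub>E {0..1::real}) | (\<Pi>\<^sub>M i\<in>{1..k}. lborel). (\<Prod>i=1..k. t i) ^ m) =
         1 / real (m + 1) ^ k"
proof -
  interpret product_sigma_finite "\<lambda>_::nat. lborel :: real measure"
    by standard
  let ?f = "\<lambda>t::real. indicator {0..1} t * t ^ m"
  have f: "integrable lborel ?f" "integral\<^sup>L lborel ?f = 1 / real (m + 1)"
    using has_bochner_integral_power_01[of m] by (auto simp: has_bochner_integral_iff)
  \<comment> \<open>Points of the product space are already \<open>undefined\<close> outside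
    \<open>{1..k}\<close>, so membership in the cube depends only on the coordinates in
    \<open>{1..k}\<close>.\<close>
  have *: "indicator ({1..k} \<rightarrow>\<^sub>E {0..1}) t *\<^sub>R (\<Prod>i=1..k. t i) ^ m = (\<Prod>i=1..k. ?f (t i))"
    if "t \<in> space (\<Pi>\<^sub>M i\<in>{1..k}. lborel)" for t :: "nat \<Rightarrow> real"
  proof -
    have "indicator ({1..k} \<rightarrow>\<^sub>E {0..1}) t = (\<Prod>i=1..k. indicator {0..1} (t i) :: real)"
      using that by (auto simp: indicator_def space_PiM PiE_def Pi_def)
    then show ?thesis
      by (simp add: prod.distrib prod_power_distrib)
  qed
  show "set_integrable (\<Pi>\<^sub>M i\<in>{1..k}. lborel) ({1..k} \<rightarrow>\<^sub>E {0..1::real}) (\<lambda>t. (\<Prod>i=1..k. t i) ^ m)"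
    unfolding set_integrable_def
    using product_integrable_prod[of "{1..k}" "\<lambda>_. ?f"] f
    by (subst Bochner_Integration.integrable_cong[OF refl *]) auto
  show "(LINT t : ({1..k} \<rightarrow>\<^sub>E {0..1::real}) | (\<Pi>\<^sub>M i\<in>{1..k}. lborel). (\<Prod>i=1..k. t i) ^ m) =
         1 / real (m + 1) ^ k"
    unfolding set_lebesgue_integral_def
    using product_integral_prod[of "{1..k}" "\<lambda>_. ?f"] f
    by (subst Bochner_Integration.integral_cong[OF refl *]) (auto simp: power_divide)
qed

text \<open>By linearity. Both kinds of polynomial are instances, differing only in the coefficients
  \<open>c\<close>.\<close>

lemma set_integral_polynomial_prod_cube:
  fixes k n :: nat and c :: "nat \<Rightarrow> real"
  shows "(LINT t : ({1..k} \<rightarrow>\<^sub>E {0..1::real}) | (\<Pi>\<^sub>M i\<in>{1..k}. lborel).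
            \<Sum>m=0..n. c m * (\<Prod>i=1..k. t i) ^ m) = (\<Sum>m=0..n. c m / real (m + 1) ^ k)"
proof -
  let ?M = "\<Pi>\<^sub>M i\<in>{1..k}. lborel :: real measure" and ?C = "{1..k} \<rightarrow>\<^sub>E {0..1::real}"
  \<comment> \<open>Interchanging sum and integral needs each monomial to be integrable over the
    cube.\<close>
  have "(LINT t : ?C | ?M. \<Sum>m=0..n. c m * (\<Prod>i=1..k. t i) ^ m) =
        (\<Sum>m=0..n. LINT t : ?C | ?M. c m * (\<Prod>i=1..k. t i) ^ m)"
    using set_integrable_prod_power_cube[of k] unfolding set_integrable_def set_lebesgue_integral_def
    by (simp add: sum_distrib_left mult.left_commute)
  then show ?thesis
    by (simp only: set_integral_mult_right set_integral_prod_power_cube) simp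
qed

lemma fact_times_gbinomial:
  "fact n * (a gchoose n) = (-1) ^ n * pochhammer (- a) n" for a :: "'a::field_char_0"
  by (simp add: gbinomial_pochhammer)

theorem proposition6:
  fixes n k :: nat and x :: real
  assumes "k \<ge> 1"
  shows "poly_cauchy1 k n x =
           (\<Sum>m=0..n. (- 1) ^ (n - m) / real (m + 1) ^ k * gen_stirling1 x n m) \<and>
         poly_cauchy2 k n (- x) =
           (- 1) ^ n * (\<Sum>m=0..n. 1 / real (m + 1) ^ k * gen_stirling1 x n m)"
proof
  \<comment> \<open>Here \<open>p\<close> stands for the product of the coordinates. The rising
    factorial is that of \<open>x + (- p)\<close>, which produces the alternating signs.\<close>
  have "fact n * ((p - x) gchoose n) =
      (\<Sum>m=0..n. ((-1) ^ (n - m) * gen_stirling1 x n m) * p ^ m)" for p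
  proof -
    have "fact n * ((p - x) gchoose n) = (-1) ^ n * (\<Sum>m=0..n. gen_stirling1 x n m * (- p) ^ m)"
      using pochhammer_add_eq_gen_stirling1[of x "- p" n] by (simp add: fact_times_gbinomial)
    also have "\<dots> = (\<Sum>m=0..n. ((-1) ^ n * (-1) ^ m * gen_stirling1 x n m) * p ^ m)"
      by (simp add: sum_distrib_left power_minus[of p] mult_ac)
    also have "\<dots> = (\<Sum>m=0..n. ((-1) ^ (n - m) * gen_stirling1 x n m) * p ^ m)"
      \<comment> \<open>For \<open>m \<le> n\<close>, the numbers \<open>n + m\<close> and
        \<open>n - m\<close> have the same parity.\<close>
      by (intro sum.cong) (auto simp: minus_one_power_iff)
    finally show ?thesis .
  qed
  then show "poly_cauchy1 k n x =
      (\<Sum>m=0..n. (- 1) ^ (n - m) / real (m + 1) ^ k * gen_stirling1 x n m)"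
    \<comment> \<open>Moving \<open>fact n\<close> under the integral lets the pointwise identity
      rewrite the integrand.\<close>
    unfolding poly_cauchy1_def set_integral_mult_right[symmetric]
    by (simp only: set_integral_polynomial_prod_cube) (simp add: mult_ac)
  \<comment> \<open>Negating \<open>- x - p\<close> gives \<open>x + p\<close>, so only the global
    sign \<open>(-1) ^ n\<close> remains.\<close>
  have "fact n * ((- x - p) gchoose n) =
      (\<Sum>m=0..n. ((-1) ^ n * gen_stirling1 x n m) * p ^ m)" for p
    using pochhammer_add_eq_gen_stirling1[of x p n]
    by (simp add: fact_times_gbinomial sum_distrib_left mult_ac add.commute)
  then show "poly_cauchy2 k n (- x) =
      (- 1) ^ n * (\<Sum>m=0..n. 1 / real (m + 1) ^ k * gen_stirling1 x n m)"
    unfolding poly_cauchy2_def set_integral_mult_right[symmetric]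
    by (simp only: set_integral_polynomial_prod_cube) (simp add: sum_distrib_left mult_ac)
qed

end
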